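(* Let $F=\langle g_0,g_1,g_2,\ldots \mid g_n g_k = g_k g_{n+1},\ 0\le k<n<\infty\rangle$ be the Thompson group, let $\mathbb{C}(F)$ be its group $*$-algebra, and let $\varphi:\mathbb{C}(F)\to\mathbb{C}$ be the linear functional determined on group elements by $\varphi(e)=1$ and $\varphi(x)=0$ for $x\in F\setminus\{e\}$. Let $$a_n=\frac{g_n+g_n^*}{\sqrt2}\in\mathbb{C}(F),\quad n\in\mathbb{N}_0,\qquad s_n=\frac{1}{\sqrt n}\,(a_0+\cdots+a_{n-1}),\quad n\in\mathbb{N}.$$ Then for every $d\in\mathbb{N}$, $$\lim_{n\to\infty}\varphi(s_n^d)=\begin{cases}(d-1)!! & \text{for } d \text{ even},\\ 0 & \text{for } d\text{ odd.}\end{cases}$$ That is, $s_n$ converges in distribution to $x$, where $x$ is a (centered) normally distributed random variable of variance $1$.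
   Context: $\mathbb{N}=\{1,2,\ldots\}$ and $\mathbb{N}_0=\{0,1,2,\ldots\}$. In the group $*$-algebra $\mathbb{C}(F)$ each $g\in F$ is unitary, with $g^*=g^{-1}$. The identity of $F$ is denoted $e$. For even $d$, $(d-1)!!=(d-1)(d-3)\cdots 3\cdot 1$. A non-commutative probability space $(\mathcal{A},\varphi)$ is a unital $*$-algebra $\mathcal{A}$ over $\mathbb{C}$ with a unital positive linear functional $\varphi$. For non-commutative probability spaces $(\mathcal{A}_n,\varphi_n)$ and $(\mathcal{A},\varphi)$ and elements $a_n\in\mathcal{A}_n$, $a\in\mathcal{A}$, one says that $(a_n)$ converges in distribution to $a$ if $\lim_{n\to\infty}\varphi_n(a_n^d)=\varphi(a^d)$ for all $d\in\mathbb{N}$. For the classical random variable $x$, $\varphi(x^d)$ means the expectation of $x^d$. *)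

theory Defs
  imports "HOL-Probability.Probability" "HOL-Library.Poly_Mapping"
begin

section \<open>The Thompson group by generators and relations\<close>

text \<open>
  The letter \<open>(n, True)\<close> stands for the generator \<open>g\<^sub>n\<close> and \<open>(n, False)\<close> for its formal inverse.
  Two words are related iff they represent the same element of
  \<open>\<langle>g\<^sub>0, g\<^sub>1, \<dots> | g\<^sub>n g\<^sub>k = g\<^sub>k g\<^sub>n\<^sub>+\<^sub>1, k < n\<rangle>\<close>.
\<close>

type_synonym word = "(nat \<times> bool) list"

inductive thompson_eq :: "word \<Rightarrow> word \<Rightarrow> bool" where
  refl: "thompson_eq w w"
| sym: "thompson_eq v w \<Longrightarrow> thompson_eq w v"
| trans: "thompson_eq u v \<Longrightarrow> thompson_eq v w \<Longrightarrow> thompson_eq u w"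
| cancel: "thompson_eq (u @ [(n, b), (n, \<not> b)] @ v) (u @ v)"
| relator: "k < n \<Longrightarrow>
    thompson_eq (u @ [(n, True), (k, True)] @ v) (u @ [(k, True), (Suc n, True)] @ v)"

lemma thompson_eq_context: "thompson_eq v w \<Longrightarrow> thompson_eq (p @ v @ q) (p @ w @ q)"
proof (induction rule: thompson_eq.induct)
  case (cancel u n b v)
  then show ?case using thompson_eq.cancel[of "p @ u" n b "v @ q"] by simp
next
  case (relator k n u v)
  then show ?case using thompson_eq.relator[of k n "p @ u" "v @ q"] by simp
qed (blast intro: thompson_eq.intros)+

lemma thompson_eq_append:
  assumes "thompson_eq v v'" "thompson_eq w w'"
  shows "thompson_eq (v @ w) (v' @ w')"
  using thompson_eq_context[OF assms(1), of "[]" w] thompson_eq_context[OF assms(2), of v' "[]"]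
  by (auto intro: thompson_eq.trans)

definition inv_word :: "word \<Rightarrow> word" where
  "inv_word w = rev (map (\<lambda>(n, b). (n, \<not> b)) w)"

lemma inv_word_simps [simp]:
  "inv_word [] = []"
  "inv_word ((n, b) # w) = inv_word w @ [(n, \<not> b)]"
  "inv_word (v @ w) = inv_word w @ inv_word v"
  by (simp_all add: inv_word_def)

lemma thompson_eq_inv_left: "thompson_eq (inv_word w @ w) []"
proof (induction w)
  case (Cons a w)
  obtain n b where a: "a = (n, b)" by (cases a)
  have "thompson_eq (inv_word w @ [(n, \<not> b), (n, \<not> \<not> b)] @ w) (inv_word w @ w)"
    by (rule thompson_eq.cancel)
  with Cons.IH show ?case by (auto simp: a intro: thompson_eq.trans)
qed (simp add: thompson_eq.refl)

lemma thompson_eq_inv_right: "thompson_eq (w @ inv_word w) []"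
proof -
  have "inv_word (inv_word w) = w" by (induction w) auto
  then show ?thesis using thompson_eq_inv_left[of "inv_word w"] by simp
qed

lemma thompson_eq_inv_word:
  assumes "thompson_eq v w"
  shows "thompson_eq (inv_word v) (inv_word w)"
proof -
  have "thompson_eq (inv_word v) (inv_word v @ (w @ inv_word w))"
    using thompson_eq_append[OF thompson_eq.refl thompson_eq_inv_right, of "inv_word v" w]
    by (auto intro: thompson_eq.sym)
  moreover have "thompson_eq (inv_word v @ (w @ inv_word w)) (inv_word v @ (v @ inv_word w))"
    using assms by (intro thompson_eq_append thompson_eq.refl) (rule thompson_eq.sym)
  moreover have "thompson_eq (inv_word v @ (v @ inv_word w)) (inv_word w)"
    using thompson_eq_append[OF thompson_eq_inv_left thompson_eq.refl, of v "inv_word w"] by simp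
  ultimately show ?thesis by (blast intro: thompson_eq.trans)
qed

quotient_type thompson = word / thompson_eq
  by (rule equivpI; rule reflpI sympI transpI) (blast intro: thompson_eq.intros)+

text \<open>
  The group law is written additively: the library has noncommutative groups as type class only
  in additive notation, and the product of \<^typ>\<open>'a \<Rightarrow>\<^sub>0 'b\<close> is the convolution with
  respect to addition on \<^typ>\<open>'a\<close>.  In particular \<open>0\<close> is the identity \<open>e\<close>
  and \<open>- x\<close> is the inverse of \<open>x\<close>.
\<close>

instantiation thompson :: group_add
begin

lift_definition zero_thompson :: thompson is "[]" .
lift_definition plus_thompson :: "thompson \<Rightarrow> thompson \<Rightarrow> thompson" is "(@)"
  by (rule thompson_eq_append)
lift_definition uminus_thompson :: "thompson \<Rightarrow> thompson" is inv_word
  by (rule thompson_eq_inv_word)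
definition minus_thompson :: "thompson \<Rightarrow> thompson \<Rightarrow> thompson" where
  "minus_thompson x y = x + - y"

instance
proof
  fix a b c :: thompson
  show "a + b + c = a + (b + c)" by transfer (simp add: thompson_eq.refl)
  show "0 + a = a" by transfer (simp add: thompson_eq.refl)
  show "a + 0 = a" by transfer (simp add: thompson_eq.refl)
  show "- a + a = 0" by transfer (rule thompson_eq_inv_left)
  show "a + - b = a - b" by (simp add: minus_thompson_def)
qed

end

lift_definition thompson_gen :: "nat \<Rightarrow> thompson" is "\<lambda>n. [(n, True)]" .

lemma thompson_gen_relation:
  "k < n \<Longrightarrow> thompson_gen n + thompson_gen k = thompson_gen k + thompson_gen (Suc n)"
  by transfer (use thompson_eq.relator[of _ _ "[]" "[]"] in simp)


section \<open>The group algebra\<close>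

type_synonym 'a group_algebra = "'a \<Rightarrow>\<^sub>0 complex"

abbreviation elt :: "'a \<Rightarrow> 'a group_algebra" where
  "elt x \<equiv> Poly_Mapping.single x 1"

abbreviation gscale :: "complex \<Rightarrow> 'a group_algebra \<Rightarrow> 'a group_algebra" where
  "gscale c \<equiv> Poly_Mapping.map ((*) c)"

lift_definition gstar :: "'a::group_add group_algebra \<Rightarrow> 'a group_algebra"
  is "\<lambda>f x. cnj (f (- x))"
proof -
  fix f :: "'a \<Rightarrow> complex"
  assume "finite {x. f x \<noteq> 0}"
  then have "finite (uminus ` {x. f x \<noteq> 0})" by simp
  moreover have "{x. cnj (f (- x)) \<noteq> 0} \<subseteq> uminus ` {x. f x \<noteq> 0}"
    by (auto intro!: image_eqI[where x = "- x" for x])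
  ultimately show "finite {x. cnj (f (- x)) \<noteq> 0}" by (rule rev_finite_subset)
qed

definition canonical_trace :: "'a::group_add group_algebra \<Rightarrow> complex" where
  "canonical_trace f = Poly_Mapping.lookup f 0"

lemma canonical_trace_elt: "canonical_trace (elt x) = (if x = 0 then 1 else 0)"
  by (simp add: canonical_trace_def lookup_single when_def)

lemma gstar_elt: "gstar (elt x) = elt (- x)"
  by transfer (auto simp: fun_eq_iff when_def)

lemma elt_unitary: "gstar (elt x) * elt x = 1" "elt x * gstar (elt x) = 1"
  by (simp_all add: gstar_elt mult_single)


section \<open>Noncommutative probability spaces\<close>

locale nc_probability_space = vector_space smult
  for smult :: "complex \<Rightarrow> 'a::ring_1 \<Rightarrow> 'a" +
  fixes adj :: "'a \<Rightarrow> 'a"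
    and \<phi> :: "'a \<Rightarrow> complex"
  assumes smult_mult_left: "smult c a * b = smult c (a * b)"
    and smult_mult_right: "a * smult c b = smult c (a * b)"
    and adj_adj: "adj (adj a) = a"
    and adj_add: "adj (a + b) = adj a + adj b"
    and adj_smult: "adj (smult c a) = smult (cnj c) (adj a)"
    and adj_mult: "adj (a * b) = adj b * adj a"
    and state_add: "\<phi> (a + b) = \<phi> a + \<phi> b"
    and state_smult: "\<phi> (smult c a) = c * \<phi> a"
    and state_one: "\<phi> 1 = 1"
    and state_pos: "\<phi> (adj a * a) \<in> \<real>\<^sub>\<ge>\<^sub>0"

lemma lookup_gscale: "Poly_Mapping.lookup (gscale c f) x = c * Poly_Mapping.lookup f x"
  by (simp add: Poly_Mapping.map.rep_eq when_def)

lemma lookup_mult_group: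
  fixes f g :: "'a::group_add group_algebra"
  shows "Poly_Mapping.lookup (f * g) k
    = (\<Sum>l\<in>Poly_Mapping.keys f. Poly_Mapping.lookup f l * Poly_Mapping.lookup g (- l + k))"
proof -
  have eq: "k = l + q \<longleftrightarrow> - l + k = q" for l q :: 'a
    by (metis add.assoc add_0_left left_minus minus_minus)
  have "Poly_Mapping.lookup (f * g) k
      = Sum_any (\<lambda>l. Poly_Mapping.lookup f l * Poly_Mapping.lookup g (- l + k))"
    by (simp add: times_poly_mapping.rep_eq prod_fun_def eq)
  also have "\<dots> = (\<Sum>l\<in>Poly_Mapping.keys f. Poly_Mapping.lookup f l * Poly_Mapping.lookup g (- l + k))"
    by (rule Sum_any.expand_superset) (auto simp: in_keys_iff)
  finally show ?thesis .
qed

lemma keys_gstar: "Poly_Mapping.keys (gstar f) = uminus ` Poly_Mapping.keys f"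
  by (force simp: in_keys_iff gstar.rep_eq image_iff intro: bexI[of _ "- x" for x])

lemma gstar_mult: "gstar (f * g) = gstar g * gstar f"
proof (rule poly_mapping_eqI)
  fix k
  let ?f = "Poly_Mapping.lookup f" and ?g = "Poly_Mapping.lookup g"
  have 1: "Poly_Mapping.lookup (gstar (f * g)) k
      = (\<Sum>l\<in>Poly_Mapping.keys f. cnj (?f l) * cnj (?g (- l + - k)))"
    by (simp add: gstar.rep_eq lookup_mult_group)
  have 2: "Poly_Mapping.lookup (gstar g * gstar f) k
      = (\<Sum>m\<in>Poly_Mapping.keys g. cnj (?g m) * cnj (?f (- k + - m)))"
    by (simp add: gstar.rep_eq lookup_mult_group keys_gstar sum.reindex minus_add)
  let ?A = "{l\<in>Poly_Mapping.keys f. ?g (- l + - k) \<noteq> 0}"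
  let ?B = "{m\<in>Poly_Mapping.keys g. ?f (- k + - m) \<noteq> 0}"
  have "(\<Sum>l\<in>Poly_Mapping.keys f. cnj (?f l) * cnj (?g (- l + - k)))
      = (\<Sum>l\<in>?A. cnj (?f l) * cnj (?g (- l + - k)))"
    by (rule sum.mono_neutral_right) auto
  also have "\<dots> = (\<Sum>m\<in>?B. cnj (?g m) * cnj (?f (- k + - m)))"
    by (rule sum.reindex_bij_witness[where i = "\<lambda>m. - k + - m" and j = "\<lambda>l. - l + - k"])
       (auto simp: in_keys_iff minus_add add.assoc simp del: add_uminus_conv_diff)
  also have "\<dots> = (\<Sum>m\<in>Poly_Mapping.keys g. cnj (?g m) * cnj (?f (- k + - m)))"
    by (rule sum.mono_neutral_left) auto
  finally show "Poly_Mapping.lookup (gstar (f * g)) k = Poly_Mapping.lookup (gstar g * gstar f) k"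
    using 1 2 by simp
qed

interpretation group_algebra: nc_probability_space
  "gscale :: complex \<Rightarrow> 'a::group_add group_algebra \<Rightarrow> _" gstar canonical_trace
proof (unfold_locales, goal_cases)
  case (14 a)
  have "canonical_trace (gstar a * a) = (\<Sum>x\<in>Poly_Mapping.keys a. of_real ((cmod (Poly_Mapping.lookup a x))\<^sup>2))"
    by (simp add: canonical_trace_def lookup_mult_group keys_gstar sum.reindex gstar.rep_eq
        complex_norm_square mult.commute del: of_real_power)
  also have "\<dots> = of_real (\<Sum>x\<in>Poly_Mapping.keys a. (cmod (Poly_Mapping.lookup a x))\<^sup>2)"
    by simp
  finally show ?case
    using nonneg_Reals_of_real_iff sum_nonneg zero_le_power2 by metis
next
  case (5 c a b)
  show ?case by (simp add: mult_map_scale_conv_mult mult.assoc)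
next
  case (6 a c b)
  show ?case
    by (rule poly_mapping_eqI) (simp add: lookup_mult_group lookup_gscale sum_distrib_left mult_ac)
next
  case (10 a b)
  show ?case by (rule gstar_mult)
next
  case 13
  show ?case by (simp add: canonical_trace_def lookup_one)
qed (simp_all add: poly_mapping_eq_iff fun_eq_iff lookup_gscale lookup_add gstar.rep_eq
       canonical_trace_def algebra_simps)


section \<open>The sequence and its limit\<close>

definition a_seq :: "nat \<Rightarrow> thompson group_algebra" where
  "a_seq n =
    gscale (1 / complex_of_real (sqrt 2)) (elt (thompson_gen n) + gstar (elt (thompson_gen n)))"

definition s_seq :: "nat \<Rightarrow> thompson group_algebra" where
  "s_seq n = gscale (1 / complex_of_real (sqrt (real n))) (\<Sum>i<n. a_seq i)"

fun double_factorial :: "nat \<Rightarrow> nat" where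
  "double_factorial 0 = 1"
| "double_factorial (Suc 0) = 1"
| "double_factorial (Suc (Suc n)) = Suc (Suc n) * double_factorial n"

text \<open>
  Convergence in distribution of noncommutative random variables to a classical random variable
  \<open>X\<close> is convergence of all moments, the moments of \<open>X\<close> being required to exist.
\<close>

definition converges_in_distribution_to ::
    "(nat \<Rightarrow> 'a::monoid_mult \<Rightarrow> complex) \<Rightarrow> (nat \<Rightarrow> 'a) \<Rightarrow> 'b measure \<Rightarrow> ('b \<Rightarrow> real) \<Rightarrow> bool" where
  "converges_in_distribution_to \<phi> b M X \<longleftrightarrow>
    (\<forall>d\<ge>1. integrable M (\<lambda>\<omega>. X \<omega> ^ d) \<and>
      (\<lambda>n. \<phi> n (b n ^ d)) \<longlonglongrightarrow> complex_of_real (\<integral>\<omega>. X \<omega> ^ d \<partial>M))"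

end

theory Submission
  imports Defs "HOL-Real_Asymp.Real_Asymp"
begin

text \<open>
  Expanding \<open>s\<^sub>n\<^sup>d\<close> shows that \<open>\<phi>(s\<^sub>n\<^sup>d)\<close> is \<open>(2 n)\<^bsup>-d/2\<^esup>\<close> times the number of words of
  length \<open>d\<close> in the letters \<open>g\<^sub>i\<close>, \<open>g\<^sub>i\<inverse>\<close> with \<open>i < n\<close> that represent the identity of the group.
  So the limit theorem says how fast the number of trivial words grows.
  
  The idea is to remove the smallest index \<open>k\<close> that occurs in a word.  The relations say that
  conjugation by \<open>g\<^sub>k\<close> raises every index above \<open>k\<close> by one.  Hence, if \<open>N\<close> letters \<open>g\<^sub>k\<inverse>\<close> are
  put in front of the word and pushed through it to the right, each letter \<open>g\<^sub>k\<close> absorbs one of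
  them, each letter \<open>g\<^sub>k\<inverse>\<close> adds one, and every other letter has its index raised by the number
  that passes it.  What remains is a shorter word with indices above \<open>k\<close>, the peeled word,
  followed by a power of \<open>g\<^sub>k\<inverse>\<close> (lemma \<open>evaluate_peel\<close>).  If the signs of the letters with
  index \<open>k\<close> balance, that power is again \<open>N\<close>, so the word is conjugate to the peeled word, and one
  is trivial iff the other is (\<open>evaluate_peel_eq_0_iff\<close>).  In a trivial word they must balance: in
  the action of the group on the line by piecewise linear maps, the slope of the word immediately
  to the right of \<open>k\<close> is two to the sum of these signs (\<open>ups_eq_downs\<close>).
  
  Take \<open>N = d\<close>, so that the supply of letters \<open>g\<^sub>k\<inverse>\<close> never runs out.  Once \<open>k\<close> and the pattern,
  i.e. the positions and signs of the letters with index \<open>k\<close>, are fixed, a word can be recovered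
  from its peeled word, and the indices move by at most \<open>2 d\<close>.  Whether a word is
  trivial is not affected by a common shift of positive indices, since such a shift is conjugation
  by a power of \<open>g\<^sub>0\<close>.  Therefore the number of trivial words of length \<open>d\<close> with indices in a window
  of size \<open>L\<close> is squeezed between two sums, over \<open>j < L\<close> and the balanced patterns, of the number
  of trivial words of the remaining length with indices in a window of size \<open>j - 2 d\<close> or \<open>j + 2 d\<close>
  (\<open>card_trivial_words_sandwich\<close>).
  
  A pattern with \<open>r\<close> marks contributes a term of order at most \<open>L\<^bsup>(d-r)/2 + 1\<^esup>\<close>.  Compared with \<open>L\<^bsup>d/2\<^esup>\<close> only
  the \<open>d (d - 1)\<close> patterns with one \<open>g\<^sub>k\<close> and one \<open>g\<^sub>k\<inverse>\<close> survive, and summation over \<open>j\<close> contributes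
  a factor \<open>2 / d\<close>.  So the numbers \<open>c\<^sub>d\<close> for which the count is asymptotic to \<open>c\<^sub>d L\<^bsup>d/2\<^esup>\<close> satisfy
  \<open>c\<^sub>d = 2 (d - 1) c\<^bsub>d-2\<^esub>\<close> with \<open>c\<^sub>0 = 1\<close> and \<open>c\<^sub>1 = 0\<close> (\<open>tendsto_card_trivial_words\<close>).  Up to
  the factor \<open>2\<^bsup>d/2\<^esup>\<close> this is the recursion of the moments of the standard normal distribution.
\<close>

section \<open>Conjugation by a generator\<close>

abbreviation evaluate :: "word \<Rightarrow> thompson" where
  "evaluate \<equiv> abs_thompson"

lemma evaluate_append [simp]: "evaluate (u @ v) = evaluate u + evaluate v"
  by (simp add: plus_thompson.abs_eq)

lemma evaluate_Nil [simp]: "evaluate [] = 0"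
  by (simp add: zero_thompson.abs_eq)

lemma evaluate_Cons: "evaluate (l # w) = evaluate [l] + evaluate w"
  using evaluate_append[of "[l]" w] by simp

lemma evaluate_letter:
  "evaluate [(i, True)] = thompson_gen i" "evaluate [(i, False)] = - thompson_gen i"
  by (simp_all add: thompson_gen.abs_eq uminus_thompson.abs_eq)

lemma evaluate_eq_0_iff: "evaluate w = 0 \<longleftrightarrow> thompson_eq w []"
  using thompson.abs_eq_iff[of w "[]"] by simp

text \<open>
  The defining relations in the form used throughout.  Since \<open>+\<close> is the group law, this reads
  \<open>g\<^sub>k\<inverse> g\<^sub>i\<^sup>\<plusminus>\<^sup>1 = g\<^sub>i\<^sub>+\<^sub>1\<^sup>\<plusminus>\<^sup>1 g\<^sub>k\<inverse>\<close>.
\<close>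

lemma conjugate_letter:
  assumes "k < i"
  shows "- thompson_gen k + evaluate [(i, b)] = evaluate [(Suc i, b)] + - thompson_gen k"
proof -
  have rel: "- thompson_gen k + thompson_gen i = thompson_gen (Suc i) + - thompson_gen k"
  proof -
    have "- thompson_gen k + thompson_gen i
        = - thompson_gen k + (thompson_gen i + thompson_gen k) + - thompson_gen k"
      by (simp only: add.assoc right_minus add_0_right)
    also have "\<dots> = thompson_gen (Suc i) + - thompson_gen k"
      unfolding thompson_gen_relation[OF assms] by (simp only: minus_add_cancel)
    finally show ?thesis .
  qed
  show ?thesis
  proof (cases b)
    case True
    then show ?thesis using rel by (simp only: evaluate_letter)
  next
    case False
    have "- thompson_gen k + - thompson_gen i = - (thompson_gen i + thompson_gen k)"
      by (simp only: minus_add)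
    also have "\<dots> = - thompson_gen (Suc i) + - thompson_gen k"
      by (simp only: thompson_gen_relation[OF assms] minus_add)
    finally show ?thesis using False by (simp only: evaluate_letter)
  qed
qed

lemma conjugate_letter_replicate:
  assumes "k < i"
  shows "evaluate (replicate N (k, False)) + evaluate [(i, b)]
    = evaluate [(i + N, b)] + evaluate (replicate N (k, False))"
proof (induction N)
  case (Suc N)
  let ?G = "evaluate (replicate N (k, False))"
  have rep: "evaluate (replicate (Suc N) (k, False)) = - thompson_gen k + ?G"
    unfolding replicate_Suc by (simp only: evaluate_Cons[of _ "replicate N _"] evaluate_letter)
  have "evaluate (replicate (Suc N) (k, False)) + evaluate [(i, b)]
      = (- thompson_gen k + evaluate [(i + N, b)]) + ?G"
    by (simp only: rep Suc.IH add.assoc)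
  also have "\<dots> = evaluate [(Suc (i + N), b)] + - thompson_gen k + ?G"
    using assms by (simp only: conjugate_letter[of k "i + N" b] trans_less_add1)
  also have "\<dots> = evaluate [(i + Suc N, b)] + evaluate (replicate (Suc N) (k, False))"
    by (simp only: rep add.assoc add_Suc_right)
  finally show ?case .
qed simp

section \<open>Peeling off the smallest index\<close>

fun mark :: "nat \<Rightarrow> nat \<times> bool \<Rightarrow> bool option" where
  "mark k (i, b) = (if i = k then Some b else None)"

abbreviation pattern :: "nat \<Rightarrow> word \<Rightarrow> bool option list" where
  "pattern k \<equiv> map (mark k)"

text \<open>
  The number of letters \<open>g\<^sub>k\<inverse>\<close> that are still being pushed to the right, after \<open>N\<close> of them have met a
  letter with this mark.  At \<open>N = 0\<close> the subtraction truncates; only words with at most \<open>N\<close>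
  letters are peeled, for which this does not happen.
\<close>

fun shift_after :: "bool option \<Rightarrow> nat \<Rightarrow> nat" where
  "shift_after None N = N"
| "shift_after (Some True) N = N - 1"
| "shift_after (Some False) N = Suc N"

fun peel :: "nat \<Rightarrow> nat \<Rightarrow> word \<Rightarrow> word" where
  "peel k N [] = []"
| "peel k N ((i, b) # w) = (if i = k then peel k (shift_after (Some b) N) w
     else (i + N, b) # peel k N w)"

text \<open>
  The inverse of peeling: the letters of the peeled word are put back, with lowered indices, at the
  blank positions of the pattern.
\<close>

fun fill :: "nat \<Rightarrow> nat \<Rightarrow> bool option list \<Rightarrow> word \<Rightarrow> word" where
  "fill k N [] v = []"
| "fill k N (Some b # \<pi>) v = (k, b) # fill k (shift_after (Some b) N) \<pi> v"
| "fill k N (None # \<pi>) [] = []"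
| "fill k N (None # \<pi>) ((j, b) # v) = (j - N, b) # fill k N \<pi> v"

abbreviation ups :: "bool option list \<Rightarrow> nat" where
  "ups \<pi> \<equiv> count_list \<pi> (Some True)"
abbreviation downs :: "bool option list \<Rightarrow> nat" where
  "downs \<pi> \<equiv> count_list \<pi> (Some False)"
abbreviation blanks :: "bool option list \<Rightarrow> nat" where
  "blanks \<pi> \<equiv> count_list \<pi> None"

lemma length_eq_ups_downs_blanks: "length \<pi> = ups \<pi> + downs \<pi> + blanks \<pi>"
proof (induction \<pi>)
  case (Cons x \<pi>)
  then show ?case by (cases x rule: option.exhaust) auto
qed simp

text \<open>
  The letters \<open>g\<^sub>k\<inverse>\<close> in front are pushed through \<open>w\<close> one letter at a time.  The bound on the length
  keeps one available for each letter \<open>g\<^sub>k\<close> that has to be absorbed.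
\<close>

lemma evaluate_peel:
  assumes "fst ` set w \<subseteq> {k..}" "length w \<le> N"
  shows "evaluate (replicate N (k, False)) + evaluate w
    = evaluate (peel k N w)
      + evaluate (replicate (N + downs (pattern k w) - ups (pattern k w)) (k, False))"
  using assms
proof (induction w arbitrary: N)
  case (Cons l w)
  obtain i b where l: "l = (i, b)" by (cases l)
  let ?G = "\<lambda>M. evaluate (replicate M (k, False))"
  let ?w = "pattern k w"
  have i: "i \<ge> k" using Cons.prems l by auto
  show ?case
  proof (cases "i = k")
    case False
    with i have "k < i" by simp
    have "?G N + evaluate (l # w) = ?G N + evaluate [(i, b)] + evaluate w"
      by (simp only: l evaluate_Cons[of "(i, b)" w] add.assoc)
    also have "\<dots> = evaluate [(i + N, b)] + (?G N + evaluate w)"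
      by (simp only: conjugate_letter_replicate[OF \<open>k < i\<close>] add.assoc)
    also have "\<dots> = evaluate [(i + N, b)] + (evaluate (peel k N w)
        + ?G (N + downs ?w - ups ?w))"
      using Cons.IH[of N] Cons.prems by simp
    also have "\<dots> = evaluate (peel k N (l # w)) + ?G (N + downs ?w - ups ?w)"
      using False l by (simp add: evaluate_Cons[of _ "peel _ _ _"] add.assoc)
    finally show ?thesis using False l by simp
  next
    case ik: True
    show ?thesis
    proof (cases b)
      case True
      obtain M where M: "N = Suc M" using Cons.prems(2) by (cases N) auto
      have "?G N + evaluate (l # w)
          = ?G M + (evaluate [(k, False)] + (evaluate [(k, True)] + evaluate w))"
        unfolding M replicate_Suc replicate_append_same[symmetric] evaluate_append
          l evaluate_Cons[of "(i, b)" w] by (simp add: ik True add.assoc)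
      also have "\<dots> = ?G M + evaluate w"
        by (simp add: evaluate_letter)
      also have "\<dots> = evaluate (peel k M w) + ?G (M + downs ?w - ups ?w)"
        using Cons.IH[of M] Cons.prems M by simp
      finally show ?thesis using ik True l M by simp
    next
      case False
      have "?G N + evaluate (l # w) = ?G (Suc N) + evaluate w"
        unfolding replicate_Suc replicate_append_same[symmetric] evaluate_append
          l evaluate_Cons[of "(i, b)" w] by (simp add: ik False add.assoc)
      also have "\<dots> = evaluate (peel k (Suc N) w) + ?G (Suc N + downs ?w - ups ?w)"
        using Cons.IH[of "Suc N"] Cons.prems by simp
      finally show ?thesis using ik False l by simp
    qed
  qed
qed simp

section \<open>The exponent of the smallest index\<close>

text \<open>
  The classical action of the Thompson group on the real line: the generator \<open>g\<^sub>n\<close> is the identity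
  left of \<open>n\<close>, has slope two on the unit interval after \<open>n\<close>, and is the translation by one further
  right.  Words act from left to right, so the first letter is applied first.
\<close>

fun letter_map :: "nat \<times> bool \<Rightarrow> real \<Rightarrow> real" where
  "letter_map (n, True) x =
    (if x \<le> real n then x else if x \<le> real n + 1 then 2 * x - real n else x + 1)"
| "letter_map (n, False) x =
    (if x \<le> real n then x else if x \<le> real n + 2 then (x + real n) / 2 else x - 1)"

lemma letter_map_cancel: "letter_map (n, \<not> b) (letter_map (n, b) x) = x"
  by (cases b) (auto simp: field_simps)

lemma letter_map_relator:
  assumes "k < n"
  shows "letter_map (k, True) (letter_map (n, True) x)
    = letter_map (Suc n, True) (letter_map (k, True) x)"
proof -
  have "real k + 1 \<le> real n" using assms by linarith
  then show ?thesis by auto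
qed

lemma fold_letter_map_cong: "thompson_eq v w \<Longrightarrow> fold letter_map v = fold letter_map w"
proof (induction rule: thompson_eq.induct)
  case (cancel u n b v)
  then show ?case by (simp add: fun_eq_iff letter_map_cancel)
next
  case (relator k n u v)
  then show ?case by (simp add: fun_eq_iff letter_map_relator del: letter_map.simps)
qed auto

text \<open>
  Immediately to the right of \<open>k\<close> the letters with index above \<open>k\<close> act as the identity and those
  with index \<open>k\<close> double or halve the distance to \<open>k\<close>.  The starting distance \<open>2\<^bsup>-M\<^esup>\<close> is so
  small that the point stays within distance one of \<open>k\<close> while the word acts.
\<close>

lemma fold_letter_map_near:
  assumes "fst ` set w \<subseteq> {k..}" "length w \<le> M"
  shows "fold letter_map w (real k + 1 / 2 ^ M)
    = real k + 1 / 2 ^ (M + downs (pattern k w) - ups (pattern k w))"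
  using assms
proof (induction w arbitrary: M)
  case (Cons l w)
  obtain i b where l: "l = (i, b)" by (cases l)
  have small: "1 / 2 ^ M \<le> (1 :: real)" "1 / 2 ^ M \<le> (2 :: real)" "0 < 1 / (2 :: real) ^ M"
    by (simp_all add: divide_le_eq order.trans[of 1 "2 ^ M" "2 * 2 ^ M :: real"])
  consider "k < i" | "i = k" "b" | "i = k" "\<not> b" using Cons.prems l by force
  then show ?case
  proof cases
    case 1
    then have "real k + 1 \<le> real i" by linarith
    with small have "real k + 1 / 2 ^ M \<le> real i" by linarith
    then have "letter_map l (real k + 1 / 2 ^ M) = real k + 1 / 2 ^ M"
      unfolding l by (cases b) auto
    with Cons.IH[of M] Cons.prems 1 l show ?thesis by simp
  next
    case 2
    obtain M' where M': "M = Suc M'" using Cons.prems by (cases M) auto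
    have "letter_map l (real k + 1 / 2 ^ M) = real k + 1 / 2 ^ M'"
      using 2 small l M' by (simp add: field_simps)
    with Cons.IH[of M'] Cons.prems 2 l M' show ?thesis by simp
  next
    case 3
    have "letter_map l (real k + 1 / 2 ^ M) = real k + 1 / 2 ^ Suc M"
      using 3 small by (simp add: l add_divide_distrib not_le)
    with Cons.IH[of "Suc M"] Cons.prems 3 l show ?thesis by simp
  qed
qed simp

text \<open>
  A trivial word acts as the identity, so the factor by which it stretches the distance to \<open>k\<close> is one.
\<close>

lemma ups_eq_downs:
  assumes "evaluate w = 0" "fst ` set w \<subseteq> {k..}"
  shows "ups (pattern k w) = downs (pattern k w)"
proof -
  let ?M = "length w" and ?p = "pattern k w"
  have "fold letter_map w = fold letter_map []"
    using assms(1) by (intro fold_letter_map_cong) (simp add: evaluate_eq_0_iff)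
  then have "1 / (2 :: real) ^ ?M = 1 / 2 ^ (?M + downs ?p - ups ?p)"
    using fold_letter_map_near[OF assms(2) order_refl] by simp
  then have "?M = ?M + downs ?p - ups ?p"
    by simp
  moreover have "ups ?p \<le> ?M"
    using count_le_length[of ?p] by simp
  ultimately show ?thesis by linarith
qed

text \<open>
  For balanced signs the same power of \<open>g\<^sub>k\<inverse>\<close> stands on both sides of \<open>evaluate_peel\<close>, so \<open>w\<close> and
  its peeled word are conjugate.
\<close>

lemma evaluate_peel_eq_0_iff:
  assumes "fst ` set w \<subseteq> {k..}" "length w \<le> N" "ups (pattern k w) = downs (pattern k w)"
  shows "evaluate (peel k N w) = 0 \<longleftrightarrow> evaluate w = 0"
proof -
  let ?G = "evaluate (replicate N (k, False))"
  have N: "N + downs (pattern k w) - ups (pattern k w) = N"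
    using assms(3) by simp
  have eq: "?G + evaluate w = evaluate (peel k N w) + ?G"
    using evaluate_peel[OF assms(1,2)] unfolding N .
  show ?thesis
  proof
    assume 0: "evaluate (peel k N w) = 0"
    have "?G + evaluate w = ?G + 0" unfolding eq 0 add_0_left add_0_right ..
    then show "evaluate w = 0" by (rule add_left_imp_eq)
  next
    assume 0: "evaluate w = 0"
    have "evaluate (peel k N w) + ?G = 0 + ?G"
      unfolding eq[symmetric] 0 add_0_left add_0_right ..
    then show "evaluate (peel k N w) = 0" by (rule add_right_imp_eq)
  qed
qed

section \<open>Recovering a word from its pattern and its peeled word\<close>

lemma fill_peel: "fill k N (pattern k w) (peel k N w) = w"
  by (induction k N w rule: peel.induct) auto

lemma length_peel: "length (peel k N w) = blanks (pattern k w)"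
  by (induction k N w rule: peel.induct) auto

lemma shift_after_le: "shift_after x N \<le> Suc N"
  by (cases "(x, N)" rule: shift_after.cases) auto

lemma peel_indices:
  assumes "fst ` set w \<subseteq> {k..<b}"
  shows "fst ` set (peel k N w) \<subseteq> {Suc k..<b + N + length w}"
  using assms
proof (induction k N w rule: peel.induct)
  case (2 k N i c w)
  show ?case
  proof (cases "i = k")
    case True
    with 2 have "fst ` set (peel k (shift_after (Some c) N) w)
        \<subseteq> {Suc k..<b + shift_after (Some c) N + length w}" by simp
    also have "\<dots> \<subseteq> {Suc k..<b + N + length ((i, c) # w)}"
      using shift_after_le[of "Some c" N] by auto
    finally show ?thesis using True by simp
  next
    case False
    with 2 show ?thesis by auto
  qed
qed simp

text \<open>
  The indices must exceed \<open>k\<close> by more than the largest amount, \<open>N + length \<pi>\<close>, by which any of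
  them can be lowered, so that no filled-in letter collides with the index \<open>k\<close>.
\<close>

lemma fill_properties:
  assumes "length v = blanks \<pi>" "fst ` set v \<subseteq> {k + N + length \<pi><..<b}" "k < b"
  shows "peel k N (fill k N \<pi> v) = v \<and> pattern k (fill k N \<pi> v) = \<pi>
    \<and> fst ` set (fill k N \<pi> v) \<subseteq> {k..<b}"
  using assms
proof (induction k N \<pi> v rule: fill.induct)
  case (2 k N c \<pi> v)
  have "k + shift_after (Some c) N + length \<pi> \<le> k + N + length (Some c # \<pi>)"
    using shift_after_le[of "Some c" N] by simp
  then have "{k + N + length (Some c # \<pi>)<..<b} \<subseteq> {k + shift_after (Some c) N + length \<pi><..<b}"
    by auto
  with 2(3) have "fst ` set v \<subseteq> {k + shift_after (Some c) N + length \<pi><..<b}" by blast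
  with 2 show ?case by simp
next
  case (4 k N \<pi> j c v)
  have "fst ` set v \<subseteq> {k + N + length \<pi><..<b}" "j - N > k" "j < b" "j \<ge> N"
    using 4(3) by auto
  with 4(1,2,4) show ?case by simp
qed simp_all

section \<open>Counting trivial words by their smallest index\<close>

definition trivial_words :: "nat \<Rightarrow> nat \<Rightarrow> nat \<Rightarrow> word set" where
  "trivial_words d a b = {w. length w = d \<and> fst ` set w \<subseteq> {a..<b} \<and> evaluate w = 0}"

lemma fst_image_subset_iff: "fst ` set w \<subseteq> A \<longleftrightarrow> set w \<subseteq> A \<times> UNIV"
  by auto

lemma finite_trivial_words [simp]: "finite (trivial_words d a b)"
proof (rule finite_subset)
  show "trivial_words d a b \<subseteq> {w. set w \<subseteq> {a..<b} \<times> UNIV \<and> length w = d}"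
    by (auto simp: trivial_words_def fst_image_subset_iff)
  show "finite {w :: word. set w \<subseteq> {a..<b} \<times> UNIV \<and> length w = d}"
    by (intro finite_lists_length_eq) auto
qed

definition shift_word :: "nat \<Rightarrow> word \<Rightarrow> word" where
  "shift_word N = map (\<lambda>(i, b). (i + N, b))"

text \<open>
  For words that avoid the index zero, raising all indices by \<open>N\<close> is conjugation by \<open>g\<^sub>0\<^sup>N\<close>.
\<close>

lemma evaluate_shift_word:
  assumes "0 \<notin> fst ` set w"
  shows "evaluate (replicate N (0, False)) + evaluate w
    = evaluate (shift_word N w) + evaluate (replicate N (0, False))"
  using assms
proof (induction w)
  case (Cons l w)
  obtain i b where l: "l = (i, b)" by (cases l)
  let ?G = "evaluate (replicate N (0, False))"
  have "0 < i" using Cons.prems l by force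
  have "?G + evaluate (l # w) = (?G + evaluate [(i, b)]) + evaluate w"
    by (simp only: l evaluate_Cons[of "(i, b)" w] add.assoc)
  also have "\<dots> = evaluate [(i + N, b)] + (?G + evaluate w)"
    by (simp only: conjugate_letter_replicate[OF \<open>0 < i\<close>] add.assoc)
  also have "\<dots> = evaluate [(i + N, b)] + evaluate (shift_word N w) + ?G"
    using Cons by (simp add: add.assoc)
  also have "\<dots> = evaluate (shift_word N (l # w)) + ?G"
    by (simp add: shift_word_def l evaluate_Cons[of _ "map _ _"])
  finally show ?case .
qed (simp add: shift_word_def)

lemma evaluate_shift_word_eq_0_iff:
  assumes "0 \<notin> fst ` set w"
  shows "evaluate (shift_word N w) = 0 \<longleftrightarrow> evaluate w = 0"
  using evaluate_shift_word[OF assms, of N]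
  by (metis add_0_left add_0_right add_left_cancel add_right_cancel)

text \<open>
  The count depends on the size of the window only, as long as the window does not contain zero.
  The windows that remain after peeling satisfy this, since they lie above the peeled index.
\<close>

lemma card_trivial_words_shift:
  "card (trivial_words q (Suc c) b) = card (trivial_words q 1 (1 + (b - Suc c)))"
proof -
  let ?S = "trivial_words q 1 (1 + (b - Suc c))" and ?T = "trivial_words q (Suc c) b"
  have zero: "0 \<notin> fst ` set w" if "w \<in> ?S" for w
    using that by (force simp: trivial_words_def)
  have inj: "inj_on (shift_word c) ?S"
    by (rule inj_onI) (auto simp: shift_word_def inj_on_def dest!: map_inj_on[rotated])
  have "shift_word c ` ?S = ?T"
  proof (intro subset_antisym subsetI)
    fix v assume "v \<in> shift_word c ` ?S"
    then obtain w where w: "v = shift_word c w" "w \<in> ?S" by auto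
    then have "evaluate v = 0"
      using evaluate_shift_word_eq_0_iff[OF zero] by (auto simp: trivial_words_def)
    moreover have "length v = q" "fst ` set v \<subseteq> {Suc c..<b}"
      using w by (force simp: trivial_words_def shift_word_def)+
    ultimately show "v \<in> ?T" by (simp add: trivial_words_def)
  next
    fix v assume v: "v \<in> ?T"
    define w where "w = map (\<lambda>(i, b). (i - c, b)) v"
    have "shift_word c w = map (\<lambda>x. x) v"
      using v unfolding w_def shift_word_def map_map
      by (intro map_cong) (force simp: trivial_words_def)+
    then have vw: "v = shift_word c w" by simp
    have idx: "fst ` set w \<subseteq> {1..<1 + (b - Suc c)}"
      using v by (force simp: w_def trivial_words_def)
    then have "0 \<notin> fst ` set w" by force
    then have "evaluate w = 0"
      using v vw evaluate_shift_word_eq_0_iff by (auto simp: trivial_words_def)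
    then have "w \<in> ?S"
      using idx v by (auto simp: w_def trivial_words_def)
    with vw show "v \<in> shift_word c ` ?S" by blast
  qed
  with card_image[OF inj] show ?thesis by simp
qed

definition window_count :: "nat \<Rightarrow> nat \<Rightarrow> nat" where
  "window_count q L = card (trivial_words q 1 (1 + L))"

text \<open>
  The possible patterns of the smallest index of a trivial word.  As that index occurs, and as its
  signs balance, it occurs with both signs.
\<close>

definition balanced_patterns :: "nat \<Rightarrow> bool option list set" where
  "balanced_patterns d = {\<pi>. length \<pi> = d \<and> ups \<pi> = downs \<pi> \<and> 0 < ups \<pi>}"

lemma finite_balanced_patterns [simp]: "finite (balanced_patterns d)"
  by (rule finite_subset[OF _ finite_lists_length_eq[of UNIV d]])
     (auto simp: balanced_patterns_def)

definition words_with_pattern :: "nat \<Rightarrow> nat \<Rightarrow> nat \<Rightarrow> bool option list \<Rightarrow> word set" where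
  "words_with_pattern d k b \<pi> = {w \<in> trivial_words d k b. pattern k w = \<pi>}"

text \<open>
  Peeling with \<open>N = d\<close> is injective for a fixed pattern and raises indices by at most \<open>2 d\<close>.
\<close>

lemma card_words_with_pattern_le:
  assumes "\<pi> \<in> balanced_patterns d"
  shows "card (words_with_pattern d k b \<pi>) \<le> window_count (blanks \<pi>) (b - Suc k + 2 * d)"
proof -
  let ?S = "words_with_pattern d k b \<pi>"
  have "card ?S \<le> card (trivial_words (blanks \<pi>) (Suc k) (b + 2 * d))"
  proof (rule card_inj_on_le)
    show "inj_on (peel k d) ?S"
      by (rule inj_onI) (metis (mono_tags, lifting) fill_peel words_with_pattern_def mem_Collect_eq)
    show "peel k d ` ?S \<subseteq> trivial_words (blanks \<pi>) (Suc k) (b + 2 * d)"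
    proof (intro image_subsetI)
      fix w assume w: "w \<in> ?S"
      then have w': "length w = d" "fst ` set w \<subseteq> {k..<b}" "evaluate w = 0" "pattern k w = \<pi>"
        by (auto simp: words_with_pattern_def trivial_words_def)
      have "fst ` set w \<subseteq> {k..}" using w'(2) by auto
      then have "evaluate (peel k d w) = 0"
        using evaluate_peel_eq_0_iff[of w k d] w' assms by (simp add: balanced_patterns_def)
      then show "peel k d w \<in> trivial_words (blanks \<pi>) (Suc k) (b + 2 * d)"
        using peel_indices[OF w'(2), of d] w' by (simp add: trivial_words_def length_peel mult_2 add.assoc)
    qed
  qed simp
  also have "\<dots> = window_count (blanks \<pi>) (b + 2 * d - Suc k)"
    unfolding window_count_def by (rule card_trivial_words_shift)
  also have "\<dots> \<le> window_count (blanks \<pi>) (b - Suc k + 2 * d)"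
    unfolding window_count_def
    by (intro card_mono finite_trivial_words) (auto simp: trivial_words_def subset_iff)
  finally show ?thesis .
qed

text \<open>
  Conversely, each trivial word of the remaining length whose indices are below \<open>b\<close> and exceed \<open>k\<close>
  by more than \<open>2 d\<close> is the peeled word of a trivial word with the given pattern.
\<close>

lemma card_words_with_pattern_ge:
  assumes "\<pi> \<in> balanced_patterns d" "k < b"
  shows "window_count (blanks \<pi>) (b - Suc k - 2 * d) \<le> card (words_with_pattern d k b \<pi>)"
proof -
  let ?S = "trivial_words (blanks \<pi>) (Suc (k + 2 * d)) b"
  have d: "length \<pi> = d" "ups \<pi> = downs \<pi>" using assms by (auto simp: balanced_patterns_def)
  have fill: "peel k d (fill k d \<pi> v) = v" "pattern k (fill k d \<pi> v) = \<pi>"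
    "fst ` set (fill k d \<pi> v) \<subseteq> {k..<b}" if "v \<in> ?S" for v
  proof -
    have "fst ` set v \<subseteq> {k + d + length \<pi><..<b}" "length v = blanks \<pi>"
      using that d by (force simp: trivial_words_def)+
    then show "peel k d (fill k d \<pi> v) = v" "pattern k (fill k d \<pi> v) = \<pi>"
      "fst ` set (fill k d \<pi> v) \<subseteq> {k..<b}"
      using fill_properties[of v \<pi> k d b] assms(2) by blast+
  qed
  have "window_count (blanks \<pi>) (b - Suc k - 2 * d) = card ?S"
    unfolding window_count_def card_trivial_words_shift by (simp add: diff_diff_eq)
  also have "card ?S \<le> card (words_with_pattern d k b \<pi>)"
  proof (rule card_inj_on_le)
    show "inj_on (fill k d \<pi>) ?S"
      by (rule inj_on_inverseI[of _ "peel k d"]) (rule fill)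
    show "finite (words_with_pattern d k b \<pi>)"
      by (simp add: words_with_pattern_def)
    show "fill k d \<pi> ` ?S \<subseteq> words_with_pattern d k b \<pi>"
    proof (intro image_subsetI)
      fix v assume v: "v \<in> ?S"
      let ?w = "fill k d \<pi> v"
      have len: "length ?w = d"
        using fill(2)[OF v] d(1) by (metis length_map)
      have "fst ` set ?w \<subseteq> {k..}" using fill(3)[OF v] by auto
      then have "evaluate ?w = 0"
        using evaluate_peel_eq_0_iff[of ?w k d] len fill(1,2)[OF v] d v
        by (simp add: trivial_words_def)
      then show "?w \<in> words_with_pattern d k b \<pi>"
        using fill(2,3)[OF v] len by (simp add: words_with_pattern_def trivial_words_def)
    qed
  qed
  finally show ?thesis .
qed

lemma card_trivial_words_by_pattern:
  assumes "0 < d"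
  shows "card (trivial_words d a b)
    = (\<Sum>k\<in>{a..<b}. \<Sum>\<pi>\<in>balanced_patterns d. card (words_with_pattern d k b \<pi>))"
proof -
  let ?min = "\<lambda>w :: word. Min (fst ` set w)"
  let ?key = "\<lambda>w. (?min w, pattern (?min w) w)"
  let ?T = "{a..<b} \<times> balanced_patterns d"
  let ?W = "trivial_words d a b"
  have min: "?min w \<in> fst ` set w" "fst ` set w \<subseteq> {?min w..<b}" if "w \<in> ?W" for w
  proof -
    from that assms have "w \<noteq> []" by (auto simp: trivial_words_def)
    then show "?min w \<in> fst ` set w" by (intro Min_in) auto
    show "fst ` set w \<subseteq> {?min w..<b}"
      using that by (auto simp: trivial_words_def image_subset_iff)
  qed
  have key: "?key w \<in> ?T" if wW: "w \<in> ?W" for w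
  proof -
    obtain c where "(?min w, c) \<in> set w" using min(1)[OF wW] by force
    then have "Some c \<in> set (pattern (?min w) w)" by force
    then have "0 < ups (pattern (?min w) w) \<or> 0 < downs (pattern (?min w) w)"
      using count_list_0_iff[of "pattern (?min w) w"] by (cases c) auto
    moreover have "fst ` set w \<subseteq> {?min w..}" using min(2)[OF wW] by auto
    then have "ups (pattern (?min w) w) = downs (pattern (?min w) w)"
      using wW by (intro ups_eq_downs) (auto simp: trivial_words_def)
    ultimately have "pattern (?min w) w \<in> balanced_patterns d"
      using wW by (auto simp: balanced_patterns_def trivial_words_def)
    moreover have "?min w \<in> {a..<b}"
      using min(1)[OF wW] wW unfolding trivial_words_def by blast
    ultimately show ?thesis by blast
  qed
  have fibre: "{w \<in> ?W. ?key w = (k, \<pi>)} = words_with_pattern d k b \<pi>"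
    if "k \<in> {a..<b}" "\<pi> \<in> balanced_patterns d" for k \<pi>
  proof (intro subset_antisym subsetI)
    fix w assume "w \<in> {w \<in> ?W. ?key w = (k, \<pi>)}"
    then show "w \<in> words_with_pattern d k b \<pi>"
      using min(2)[of w] by (auto simp: words_with_pattern_def trivial_words_def)
  next
    fix w assume "w \<in> words_with_pattern d k b \<pi>"
    then have w: "length w = d" "fst ` set w \<subseteq> {k..<b}" "evaluate w = 0" "pattern k w = \<pi>"
      by (auto simp: words_with_pattern_def trivial_words_def)
    have "Some True \<in> set (pattern k w)"
      using w(4) that(2) count_list_0_iff[of \<pi> "Some True"] by (auto simp: balanced_patterns_def)
    then have "k \<in> fst ` set w" by (force split: if_splits)
    then have "?min w = k" using w(2) by (intro Min_eqI) auto
    moreover have "w \<in> ?W" using w that(1) by (auto simp: trivial_words_def)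
    ultimately show "w \<in> {w \<in> ?W. ?key w = (k, \<pi>)}" using w by simp
  qed
  have "card ?W = (\<Sum>p\<in>?T. \<Sum>w\<in>{w \<in> ?W. ?key w = p}. 1)"
    by (subst sum.group) (use key in auto)
  also have "\<dots> = (\<Sum>(k, \<pi>)\<in>?T. card (words_with_pattern d k b \<pi>))"
    using fibre by (intro sum.cong) auto
  also have "\<dots> = (\<Sum>k\<in>{a..<b}. \<Sum>\<pi>\<in>balanced_patterns d. card (words_with_pattern d k b \<pi>))"
    by (simp add: sum.cartesian_product)
  finally show ?thesis .
qed

text \<open>
  Here \<open>j\<close> is the number of indices in the window above the smallest index \<open>k\<close>.
\<close>

lemma sum_window_reindex:
  "(\<Sum>k\<in>{a..<a + L}. f (a + L - Suc k)) = (\<Sum>j<L. f j :: nat)"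
  by (rule sum.reindex_bij_witness[where i = "\<lambda>j. a + L - Suc j" and j = "\<lambda>k. a + L - Suc k"]) auto

text \<open>
  The recursive inequality for the counts.  On either side the lengths \<open>blanks \<pi>\<close> are at most
  \<open>d - 2\<close>, which makes induction on the length possible.
\<close>

lemma card_trivial_words_sandwich:
  assumes "0 < d"
  shows "(\<Sum>j<L. \<Sum>\<pi>\<in>balanced_patterns d. window_count (blanks \<pi>) (j - 2 * d))
      \<le> card (trivial_words d a (a + L))" (is "?lower \<le> _")
    and "card (trivial_words d a (a + L))
      \<le> (\<Sum>j<L. \<Sum>\<pi>\<in>balanced_patterns d. window_count (blanks \<pi>) (j + 2 * d))" (is "_ \<le> ?upper")
proof -
  have "?lower = (\<Sum>k\<in>{a..<a + L}. \<Sum>\<pi>\<in>balanced_patterns d.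
      window_count (blanks \<pi>) (a + L - Suc k - 2 * d))"
    by (rule sum_window_reindex[symmetric])
  also have "\<dots> \<le> card (trivial_words d a (a + L))"
    unfolding card_trivial_words_by_pattern[OF assms]
    by (intro sum_mono card_words_with_pattern_ge) auto
  finally show "?lower \<le> card (trivial_words d a (a + L))" .
  have "card (trivial_words d a (a + L)) \<le> (\<Sum>k\<in>{a..<a + L}. \<Sum>\<pi>\<in>balanced_patterns d.
      window_count (blanks \<pi>) (a + L - Suc k + 2 * d))"
    unfolding card_trivial_words_by_pattern[OF assms]
    by (intro sum_mono card_words_with_pattern_le)
  also have "\<dots> = ?upper"
    by (rule sum_window_reindex)
  finally show "card (trivial_words d a (a + L)) \<le> ?upper" .
qed

section \<open>Patterns with two marks\<close>

lemma count_list_eq_card: "count_list xs y = card {i. i < length xs \<and> xs ! i = y}"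
  unfolding count_list_eq_length_filter length_filter_conv_card by (simp add: eq_commute)

text \<open>
  Such a pattern is given by the position \<open>p\<close> of its letter \<open>g\<^sub>k\<close> and the different position \<open>q\<close> of
  its letter \<open>g\<^sub>k\<inverse>\<close>.
\<close>

lemma card_minimal_patterns:
  assumes "2 \<le> d"
  shows "card {\<pi> \<in> balanced_patterns d. blanks \<pi> = d - 2} = d * (d - 1)"
proof -
  define place :: "nat \<times> nat \<Rightarrow> bool option list" where
    "place = (\<lambda>(p, q). map (\<lambda>i. if i = p then Some True else if i = q then Some False else None) [0..<d])"
  let ?D = "{0..<d} \<times> {0..<d} - Id"
  have idx: "{i. i < d \<and> place (p, q) ! i = Some True} = {p}"
    "{i. i < d \<and> place (p, q) ! i = Some False} = {q}" if "(p, q) \<in> ?D" for p q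
    using that by (auto simp: place_def split: if_splits)
  have "{\<pi> \<in> balanced_patterns d. blanks \<pi> = d - 2} = {\<pi>. length \<pi> = d \<and> ups \<pi> = 1 \<and> downs \<pi> = 1}"
    using assms length_eq_ups_downs_blanks by (fastforce simp: balanced_patterns_def)
  also have "\<dots> = place ` ?D"
  proof (intro subset_antisym subsetI)
    fix \<pi> :: "bool option list" assume "\<pi> \<in> {\<pi>. length \<pi> = d \<and> ups \<pi> = 1 \<and> downs \<pi> = 1}"
    then have len: "length \<pi> = d" and
      "card {i. i < d \<and> \<pi> ! i = Some True} = 1" "card {i. i < d \<and> \<pi> ! i = Some False} = 1"
      by (auto simp: count_list_eq_card)
    then obtain p q where pq: "{i. i < d \<and> \<pi> ! i = Some True} = {p}"
      "{i. i < d \<and> \<pi> ! i = Some False} = {q}"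
      by (meson card_1_singletonE)
    then have "p < d" "q < d" "\<pi> ! p = Some True" "\<pi> ! q = Some False" by blast+
    then have "(p, q) \<in> ?D" by auto
    moreover have "\<pi> = place (p, q)"
    proof (rule nth_equalityI)
      fix i assume "i < length \<pi>"
      then have i: "i < d" using len by simp
      have "\<pi> ! i = Some True \<longleftrightarrow> i = p" "\<pi> ! i = Some False \<longleftrightarrow> i = q"
        using pq i by blast+
      then show "\<pi> ! i = place (p, q) ! i"
        using i by (cases "\<pi> ! i") (auto simp: place_def)
    qed (simp add: place_def len)
    ultimately show "\<pi> \<in> place ` ?D" by blast
  next
    fix \<pi> assume "\<pi> \<in> place ` ?D"
    then obtain p q where pq: "(p, q) \<in> ?D" "\<pi> = place (p, q)"
      by (metis (lifting) image_iff surj_pair)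
    have "length \<pi> = d" by (simp add: pq place_def)
    with idx[OF pq(1)] show "\<pi> \<in> {\<pi>. length \<pi> = d \<and> ups \<pi> = 1 \<and> downs \<pi> = 1}"
      by (simp add: count_list_eq_card pq(2))
  qed
  also have "card (place ` ?D) = card ?D"
  proof (rule card_image, rule inj_onI)
    fix x y assume xy: "x \<in> ?D" "y \<in> ?D" "place x = place y"
    obtain p q p' q' where "x = (p, q)" "y = (p', q')" by (cases x, cases y)
    with xy idx[of p q] idx[of p' q'] show "x = y" by simp
  qed
  also have "?D = {0..<d} \<times> {0..<d} - (\<lambda>i. (i, i)) ` {0..<d}" by auto
  also have "card \<dots> = d * d - d"
    by (subst card_Diff_subset) (auto simp: card_image inj_on_def)
  finally show ?thesis by (simp add: diff_mult_distrib2)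
qed

lemma blanks_le:
  assumes "\<pi> \<in> balanced_patterns d"
  shows "blanks \<pi> \<le> d - 2"
  using assms length_eq_ups_downs_blanks[of \<pi>] by (auto simp: balanced_patterns_def)

section \<open>Asymptotics of sums\<close>

text \<open>
  Stolz--Cesaro theorem.  The increments of \<open>a - l b\<close> are small multiples of those of \<open>b\<close>; summing
  them bounds \<open>a - l b\<close> by a small multiple of \<open>b\<close> and a constant, and \<open>b\<close> outgrows the constant.
\<close>

lemma stolz_cesaro:
  fixes a b :: "nat \<Rightarrow> real"
  assumes mono: "\<And>n. b n < b (Suc n)" and top: "filterlim b at_top sequentially"
    and lim: "(\<lambda>n. (a (Suc n) - a n) / (b (Suc n) - b n)) \<longlonglongrightarrow> l"
  shows "(\<lambda>n. a n / b n) \<longlonglongrightarrow> l"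
proof (rule LIMSEQ_I)
  fix \<epsilon> :: real assume "\<epsilon> > 0"
  define g where "g n = a n - l * b n" for n
  from LIMSEQ_D[OF lim, of "\<epsilon> / 2"] \<open>\<epsilon> > 0\<close> obtain N where
    N: "\<And>n. n \<ge> N \<Longrightarrow> \<bar>(a (Suc n) - a n) / (b (Suc n) - b n) - l\<bar> < \<epsilon> / 2" by auto
  have increment: "\<bar>g (Suc n) - g n\<bar> \<le> \<epsilon> / 2 * (b (Suc n) - b n)" if "n \<ge> N" for n
  proof -
    have pos: "b (Suc n) - b n > 0" using mono[of n] by simp
    then have "g (Suc n) - g n
        = ((a (Suc n) - a n) / (b (Suc n) - b n) - l) * (b (Suc n) - b n)"
      by (simp add: g_def field_simps)
    then have "\<bar>g (Suc n) - g n\<bar>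
        = \<bar>(a (Suc n) - a n) / (b (Suc n) - b n) - l\<bar> * (b (Suc n) - b n)"
      using pos by (simp add: abs_mult)
    then show ?thesis using N[OF that] pos by (simp add: mult_right_mono)
  qed
  have bound: "\<bar>g n\<bar> \<le> \<bar>g N\<bar> + \<epsilon> / 2 * (b n - b N)" if "n \<ge> N" for n
    using that
  proof (induction rule: dec_induct)
    case (step n)
    have "\<bar>g (Suc n)\<bar> \<le> \<bar>g n\<bar> + \<bar>g (Suc n) - g n\<bar>" by linarith
    also have "\<dots> \<le> \<bar>g N\<bar> + \<epsilon> / 2 * (b n - b N) + \<epsilon> / 2 * (b (Suc n) - b n)"
      using step.IH increment[OF step.hyps(1)] by (rule add_mono)
    finally show ?case by (simp add: algebra_simps diff_divide_distrib)
  qed simp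
  \<comment> \<open>\<open>K\<close> bounds the constant part of the estimate for \<open>g\<close>; the summand one makes it positive and
    the inequality strict.\<close>
  define K where "K = \<bar>g N\<bar> + \<epsilon> / 2 * \<bar>b N\<bar> + 1"
  have "eventually (\<lambda>n. b n > 2 * K / \<epsilon>) sequentially"
    using top by (simp add: filterlim_at_top_dense)
  then obtain M where M: "\<And>n. n \<ge> M \<Longrightarrow> b n > 2 * K / \<epsilon>"
    by (auto simp: eventually_sequentially)
  have "norm (a n / b n - l) < \<epsilon>" if "n \<ge> max N M" for n
  proof -
    have "K > 0" using \<open>\<epsilon> > 0\<close> by (auto simp: K_def intro: add_nonneg_pos)
    have big: "2 * K / \<epsilon> < b n" using M that by simp
    then have b: "b n > 0" using \<open>K > 0\<close> \<open>\<epsilon> > 0\<close>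
      by (meson divide_pos_pos less_trans mult_pos_pos zero_less_numeral)
    have "- b N * \<epsilon> \<le> \<bar>b N\<bar> * \<epsilon>"
      using \<open>\<epsilon> > 0\<close> by (intro mult_right_mono) auto
    then have "\<bar>g n\<bar> < K + \<epsilon> / 2 * b n"
      using bound[of n] that by (simp add: K_def algebra_simps diff_divide_distrib)
    also have "K < \<epsilon> / 2 * b n"
      using big \<open>\<epsilon> > 0\<close> by (simp add: field_simps)
    finally have "\<bar>g n\<bar> < \<epsilon> * b n" by simp
    moreover have "a n / b n - l = g n / b n"
      using b by (simp add: g_def field_simps)
    ultimately show ?thesis using b by (simp add: field_simps)
  qed
  then show "\<exists>M. \<forall>n\<ge>M. norm (a n / b n - l) < \<epsilon>" by blast
qed

lemma tendsto_power_increment: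
  fixes p :: real
  assumes "p > 0"
  shows "(\<lambda>n. ((real n + 1) powr p - real n powr p) / real n powr (p - 1)) \<longlonglongrightarrow> p"
  using assms by real_asymp

lemma sqrt_power_eq_powr:
  assumes "n > 0"
  shows "sqrt (real n) ^ e = real n powr (real e / 2)"
  using assms by (simp add: powr_half_sqrt[symmetric] powr_powr powr_realpow[symmetric] mult.commute)

text \<open>
  Summation raises the order of growth from \<open>e / 2\<close> to \<open>e / 2 + 1\<close> and divides the constant by the
  new exponent, as integration of a power does.  Powers of square roots serve for the
  half-integral exponents.
\<close>

lemma tendsto_cesaro_sqrt_power:
  assumes "(\<lambda>j. f j / sqrt (real j) ^ e) \<longlonglongrightarrow> l"
  shows "(\<lambda>L. (\<Sum>j<L. f j) / sqrt (real L) ^ (e + 2)) \<longlonglongrightarrow> l / (real (e + 2) / 2)"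
proof (rule stolz_cesaro)
  let ?p = "real (e + 2) / 2" and ?b = "\<lambda>n. sqrt (real n) ^ (e + 2)"
  show "?b n < ?b (Suc n)" for n
    by (intro power_strict_mono) auto
  show "filterlim ?b at_top sequentially"
    by (intro filterlim_pow_at_top filterlim_compose[OF sqrt_at_top filterlim_real_sequentially]) auto
  have "(\<lambda>n. (?b (Suc n) - ?b n) / sqrt (real n) ^ e) \<longlonglongrightarrow> ?p"
  proof (rule Lim_transform_eventually[OF tendsto_power_increment[of ?p]])
    show "eventually (\<lambda>n. ((real n + 1) powr ?p - real n powr ?p) / real n powr (?p - 1)
        = (?b (Suc n) - ?b n) / sqrt (real n) ^ e) sequentially"
      using eventually_gt_at_top[of 0]
    proof eventually_elim
      case (elim n)
      then show ?case
        using sqrt_power_eq_powr[of "Suc n" "e + 2"] sqrt_power_eq_powr[of n "e + 2"]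
          sqrt_power_eq_powr[of n e] by (simp add: add_divide_distrib add.commute)
    qed
  qed simp
  then have "(\<lambda>n. (f n / sqrt (real n) ^ e) / ((?b (Suc n) - ?b n) / sqrt (real n) ^ e))
      \<longlonglongrightarrow> l / ?p"
    by (rule tendsto_divide[OF assms]) simp
  moreover have "eventually (\<lambda>n. (f n / sqrt (real n) ^ e) / ((?b (Suc n) - ?b n) / sqrt (real n) ^ e)
      = ((\<Sum>j<Suc n. f j) - (\<Sum>j<n. f j)) / (?b (Suc n) - ?b n)) sequentially"
    using eventually_gt_at_top[of 0] by eventually_elim simp
  ultimately show "(\<lambda>n. ((\<Sum>j<Suc n. f j) - (\<Sum>j<n. f j)) / (?b (Suc n) - ?b n)) \<longlonglongrightarrow> l / ?p"
    by (rule Lim_transform_eventually)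
qed

text \<open>
  A change of the argument by a factor tending to one does not affect the leading term, and the
  leading term vanishes when it is compared with a larger power.  It is applied to the shifted
  arguments \<open>j - 2 d\<close> and \<open>j + 2 d\<close>, and it discards the patterns with more than two marks.
\<close>

lemma tendsto_rescale:
  fixes g :: "nat \<Rightarrow> real" and h :: "nat \<Rightarrow> nat"
  assumes g: "(\<lambda>L. g L / sqrt (real L) ^ q) \<longlonglongrightarrow> c"
    and top: "filterlim h at_top sequentially" and ratio: "(\<lambda>j. real (h j) / real j) \<longlonglongrightarrow> 1"
    and "q \<le> e"
  shows "(\<lambda>j. g (h j) / sqrt (real j) ^ e) \<longlonglongrightarrow> (if q = e then c else 0)"
proof -
  have "(\<lambda>j. (1 / sqrt (real j)) ^ (e - q)) \<longlonglongrightarrow> (if q = e then 1 else 0)"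
  proof (cases "q = e")
    case False
    have "(\<lambda>j. 1 / sqrt (real j)) \<longlonglongrightarrow> 0" by real_asymp
    then have "(\<lambda>j. (1 / sqrt (real j)) ^ (e - q)) \<longlonglongrightarrow> 0 ^ (e - q)" by (intro tendsto_intros)
    with False \<open>q \<le> e\<close> show ?thesis by (simp add: zero_power)
  qed simp
  moreover have "(\<lambda>j. sqrt (real (h j) / real j) ^ q) \<longlonglongrightarrow> sqrt 1 ^ q"
    by (intro tendsto_intros ratio)
  moreover have "(\<lambda>j. g (h j) / sqrt (real (h j)) ^ q) \<longlonglongrightarrow> c"
    by (rule filterlim_compose[OF g top])
  ultimately have "(\<lambda>j. g (h j) / sqrt (real (h j)) ^ q * sqrt (real (h j) / real j) ^ q
      * (1 / sqrt (real j)) ^ (e - q)) \<longlonglongrightarrow> c * sqrt 1 ^ q * (if q = e then 1 else 0)"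
    by (intro tendsto_mult)
  then have lim: "(\<lambda>j. g (h j) / sqrt (real (h j)) ^ q * sqrt (real (h j) / real j) ^ q
      * (1 / sqrt (real j)) ^ (e - q)) \<longlonglongrightarrow> (if q = e then c else 0)"
    by (simp split: if_splits)
  show ?thesis
  proof (rule Lim_transform_eventually[OF lim])
    have "eventually (\<lambda>j. h j > 0) sequentially"
      using top[unfolded filterlim_at_top, rule_format, of 1] by eventually_elim simp
    with eventually_gt_at_top[of 0]
    show "eventually (\<lambda>j. g (h j) / sqrt (real (h j)) ^ q * sqrt (real (h j) / real j) ^ q
        * (1 / sqrt (real j)) ^ (e - q) = g (h j) / sqrt (real j) ^ e) sequentially"
    proof eventually_elim
      case (elim j)
      have "sqrt (real j) ^ e = sqrt (real j) ^ q * sqrt (real j) ^ (e - q)"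
        using \<open>q \<le> e\<close> by (simp add: power_add[symmetric])
      with elim show ?case
        by (simp add: real_sqrt_divide power_divide)
    qed
  qed
qed

section \<open>Growth of the number of trivial words\<close>

text \<open>
  At \<open>d = 0\<close> the truncated \<open>d - 1\<close> is again zero, so that the moment is one, as it should be.
\<close>

definition gaussian_moment :: "nat \<Rightarrow> real" where
  "gaussian_moment d = (if even d then real (double_factorial (d - 1)) else 0)"

lemma gaussian_moment_rec:
  assumes "2 \<le> d"
  shows "gaussian_moment d = real (d - 1) * gaussian_moment (d - 2)"
proof -
  obtain e where e: "d = Suc (Suc e)" using assms by (metis Suc_le_D numeral_2_eq_2 Suc_le_mono)
  show ?thesis unfolding e gaussian_moment_def by (cases e) (auto simp: algebra_simps)
qed

text \<open>
  Both bounds of \<open>card_trivial_words_sandwich\<close> have the same limit.  By induction the summand for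
  \<open>j\<close>, divided by \<open>j\<^bsup>(d-2)/2\<^esup>\<close>, tends to \<open>d (d - 1)\<close> times the constant for \<open>d - 2\<close>, since only patterns
  with two marks count; summation over \<open>j\<close> then divides by \<open>d / 2\<close>.
\<close>

lemma tendsto_card_trivial_words:
  "(\<lambda>L. real (card (trivial_words d a (a + L))) / sqrt (real L) ^ d) \<longlonglongrightarrow> sqrt 2 ^ d * gaussian_moment d"
proof (induction d arbitrary: a rule: less_induct)
  case (less d)
  consider "d = 0" | "d = 1" | "2 \<le> d" by linarith
  then show ?case
  proof cases
    case 1
    have "trivial_words 0 a b = {[]}" for b
      by (auto simp: trivial_words_def)
    with 1 show ?thesis by (simp add: gaussian_moment_def)
  next
    case 2
    have "balanced_patterns 1 = {}"
      using length_eq_ups_downs_blanks by (fastforce simp: balanced_patterns_def)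
    then have "card (trivial_words 1 a b) = 0" for b
      by (subst card_trivial_words_by_pattern) auto
    with 2 show ?thesis by (simp add: gaussian_moment_def)
  next
    case 3
    let ?c = "sqrt 2 ^ (d - 2) * gaussian_moment (d - 2)"
    let ?total = "\<lambda>h j. real (\<Sum>\<pi>\<in>balanced_patterns d. window_count (blanks \<pi>) (h j))"
    have lim: "(\<lambda>L. (\<Sum>j<L. ?total h j) / sqrt (real L) ^ d) \<longlonglongrightarrow> sqrt 2 ^ d * gaussian_moment d"
      if h: "filterlim h at_top sequentially" "(\<lambda>j. real (h j) / real j) \<longlonglongrightarrow> 1" for h :: "nat \<Rightarrow> nat"
    proof -
      have "(\<lambda>j. real (window_count (blanks \<pi>) (h j)) / sqrt (real j) ^ (d - 2))
          \<longlonglongrightarrow> (if blanks \<pi> = d - 2 then ?c else 0)" if "\<pi> \<in> balanced_patterns d" for \<pi>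
      proof -
        have "blanks \<pi> \<le> d - 2" "blanks \<pi> < d"
          using blanks_le[OF that] 3 by auto
        then have "(\<lambda>j. real (window_count (blanks \<pi>) (h j)) / sqrt (real j) ^ (d - 2))
          \<longlonglongrightarrow> (if blanks \<pi> = d - 2 then sqrt 2 ^ blanks \<pi> * gaussian_moment (blanks \<pi>) else 0)"
          unfolding window_count_def by (intro tendsto_rescale h less) auto
        then show ?thesis by (simp split: if_splits)
      qed
      then have "(\<lambda>j. \<Sum>\<pi>\<in>balanced_patterns d.
            real (window_count (blanks \<pi>) (h j)) / sqrt (real j) ^ (d - 2))
          \<longlonglongrightarrow> (\<Sum>\<pi>\<in>balanced_patterns d. if blanks \<pi> = d - 2 then ?c else 0)"
        by (rule tendsto_sum)
      moreover have "(\<Sum>\<pi>\<in>balanced_patterns d. if blanks \<pi> = d - 2 then ?c else 0)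
          = real (d * (d - 1)) * ?c"
        unfolding card_minimal_patterns[OF 3, symmetric] by (simp add: sum.If_cases Int_def)
      ultimately have "(\<lambda>j. ?total h j / sqrt (real j) ^ (d - 2)) \<longlonglongrightarrow> real (d * (d - 1)) * ?c"
        by (simp add: sum_divide_distrib)
      have "d - 2 + 2 = d" using 3 by simp
      with tendsto_cesaro_sqrt_power[OF \<open>_ \<longlonglongrightarrow> real (d * (d - 1)) * ?c\<close>]
      have "(\<lambda>L. (\<Sum>j<L. ?total h j) / sqrt (real L) ^ d)
          \<longlonglongrightarrow> real (d * (d - 1)) * ?c / (real d / 2)"
        by (simp only:)
      also have "real (d * (d - 1)) * ?c / (real d / 2) = 2 * sqrt 2 ^ (d - 2) * gaussian_moment d"
        using 3 by (simp add: gaussian_moment_rec[OF 3])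
      also have "2 * sqrt 2 ^ (d - 2) = sqrt 2 ^ d"
        using power_add[of "sqrt 2" "d - 2" 2] unfolding \<open>d - 2 + 2 = d\<close> by simp
      finally show ?thesis .
    qed
    show ?thesis
    proof (rule tendsto_sandwich)
      show "(\<lambda>L. (\<Sum>j<L. ?total (\<lambda>j. j - 2 * d) j) / sqrt (real L) ^ d)
          \<longlonglongrightarrow> sqrt 2 ^ d * gaussian_moment d"
      proof (rule lim)
        show "filterlim (\<lambda>j. j - 2 * d) at_top sequentially"
          by (rule filterlim_minus_const_nat_at_top)
        have "(\<lambda>j. (real j - real (2 * d)) / real j) \<longlonglongrightarrow> 1" by real_asymp
        then show "(\<lambda>j. real (j - 2 * d) / real j) \<longlonglongrightarrow> 1"
          by (rule Lim_transform_eventually)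
             (use eventually_ge_at_top[of "2 * d"] in eventually_elim, simp add: of_nat_diff)
      qed
      show "(\<lambda>L. (\<Sum>j<L. ?total (\<lambda>j. j + 2 * d) j) / sqrt (real L) ^ d)
          \<longlonglongrightarrow> sqrt 2 ^ d * gaussian_moment d"
      proof (rule lim)
        show "filterlim (\<lambda>j. j + 2 * d) at_top sequentially"
          by (rule filterlim_add_const_nat_at_top)
        show "(\<lambda>j. real (j + 2 * d) / real j) \<longlonglongrightarrow> 1"
          unfolding of_nat_add by real_asymp
      qed
      have "0 < d" using 3 by simp
      note bounds = card_trivial_words_sandwich[OF this, where a = a]
      show "eventually (\<lambda>L. (\<Sum>j<L. ?total (\<lambda>j. j - 2 * d) j) / sqrt (real L) ^ d
          \<le> real (card (trivial_words d a (a + L))) / sqrt (real L) ^ d) sequentially"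
        using bounds(1) unfolding of_nat_sum[symmetric]
        by (intro always_eventually allI divide_right_mono of_nat_mono) auto
      show "eventually (\<lambda>L. real (card (trivial_words d a (a + L))) / sqrt (real L) ^ d
          \<le> (\<Sum>j<L. ?total (\<lambda>j. j + 2 * d) j) / sqrt (real L) ^ d) sequentially"
        using bounds(2) unfolding of_nat_sum[symmetric]
        by (intro always_eventually allI divide_right_mono of_nat_mono) auto
    qed
  qed
qed

section \<open>Moments of the sequence\<close>

lemma s_seq_eq_sum:
  "s_seq n = (\<Sum>l\<in>{0..<n} \<times> UNIV.
     Poly_Mapping.single (evaluate [l]) (1 / complex_of_real (sqrt 2 * sqrt (real n))))"
proof (rule poly_mapping_eqI)
  fix x
  define \<alpha> \<beta> where "\<alpha> = 1 / complex_of_real (sqrt (real n))" and "\<beta> = 1 / complex_of_real (sqrt 2)"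
  have c: "1 / complex_of_real (sqrt 2 * sqrt (real n)) = \<alpha> * \<beta>"
    by (simp add: \<alpha>_def \<beta>_def)
  have "(\<Sum>l\<in>{0..<n} \<times> UNIV. Poly_Mapping.single (evaluate [l]) (\<alpha> * \<beta>))
      = (\<Sum>i<n. Poly_Mapping.single (thompson_gen i) (\<alpha> * \<beta>)
          + Poly_Mapping.single (- thompson_gen i) (\<alpha> * \<beta>))"
    by (simp add: sum.cartesian_product' UNIV_bool add.commute lessThan_atLeast0 evaluate_letter)
  moreover have "Poly_Mapping.lookup (s_seq n) x
      = (\<Sum>i<n. \<alpha> * (\<beta> * ((if thompson_gen i = x then 1 else 0) + (if - thompson_gen i = x then 1 else 0))))"
    by (simp only: s_seq_def a_seq_def lookup_gscale lookup_sum lookup_add gstar_elt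
        sum_distrib_left lookup_single when_def \<alpha>_def \<beta>_def)
  ultimately show "Poly_Mapping.lookup (s_seq n) x = Poly_Mapping.lookup (\<Sum>l\<in>{0..<n} \<times> UNIV.
      Poly_Mapping.single (evaluate [l]) (1 / complex_of_real (sqrt 2 * sqrt (real n)))) x"
    unfolding c by (auto simp: lookup_sum lookup_add lookup_single when_def distrib_left intro!: sum.cong)
qed

lemma power_sum_letters:
  fixes S :: "(nat \<times> bool) set"
  assumes "finite S"
  shows "(\<Sum>l\<in>S. Poly_Mapping.single (evaluate [l]) c) ^ d
    = (\<Sum>w\<in>{w. set w \<subseteq> S \<and> length w = d}. Poly_Mapping.single (evaluate w) (c ^ d :: complex))"
proof (induction d)
  case 0
  have "{w. set w \<subseteq> S \<and> length w = 0} = {[]}" by auto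
  then show ?case by simp
next
  case (Suc d)
  let ?X = "{w. set w \<subseteq> S \<and> length w = d}"
  have "(\<Sum>l\<in>S. Poly_Mapping.single (evaluate [l]) c) ^ Suc d
      = (\<Sum>l\<in>S. \<Sum>w\<in>?X. Poly_Mapping.single (evaluate (l # w)) (c ^ Suc d))"
    by (simp add: Suc.IH sum_product mult_single evaluate_Cons[symmetric])
  also have "\<dots> = (\<Sum>w\<in>?X. \<Sum>l\<in>S. Poly_Mapping.single (evaluate (l # w)) (c ^ Suc d))"
    by (rule sum.swap)
  also have "\<dots> = (\<Sum>(w, l)\<in>?X \<times> S. Poly_Mapping.single (evaluate (l # w)) (c ^ Suc d))"
    by (rule sum.cartesian_product)
  also have "\<dots> = (\<Sum>w\<in>(\<lambda>(w, l). l # w) ` (?X \<times> S). Poly_Mapping.single (evaluate w) (c ^ Suc d))"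
    by (subst sum.reindex) (auto simp: inj_on_def case_prod_unfold)
  finally show ?case by (simp only: lists_length_Suc_eq)
qed

lemma canonical_trace_s_seq_power:
  "canonical_trace (s_seq n ^ d)
    = complex_of_real (real (card (trivial_words d 0 n)) / sqrt (real n) ^ d / sqrt 2 ^ d)"
proof -
  define c where "c = 1 / complex_of_real (sqrt 2 * sqrt (real n))"
  let ?X = "{w :: word. set w \<subseteq> {0..<n} \<times> UNIV \<and> length w = d}"
  have fin: "finite ?X" by (intro finite_lists_length_eq) auto
  have "canonical_trace (s_seq n ^ d) = (\<Sum>w\<in>?X. if evaluate w = 0 then c ^ d else 0)"
    by (simp add: s_seq_eq_sum[of n, folded c_def] power_sum_letters canonical_trace_def lookup_sum lookup_single when_def)
  also have "\<dots> = of_nat (card {w \<in> ?X. evaluate w = 0}) * c ^ d"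
    using fin by (simp add: sum.If_cases Int_def)
  also have "{w \<in> ?X. evaluate w = 0} = trivial_words d 0 n"
    by (auto simp: trivial_words_def fst_image_subset_iff)
  finally show ?thesis by (simp add: c_def power_divide power_mult_distrib mult.commute)
qed

lemma tendsto_canonical_trace_s_seq_power:
  "(\<lambda>n. canonical_trace (s_seq n ^ d)) \<longlonglongrightarrow> complex_of_real (gaussian_moment d)"
proof -
  have "(\<lambda>n. real (card (trivial_words d 0 n)) / sqrt (real n) ^ d / sqrt 2 ^ d)
      \<longlonglongrightarrow> sqrt 2 ^ d * gaussian_moment d / sqrt 2 ^ d"
    using tendsto_card_trivial_words[of d 0] by (intro tendsto_divide) auto
  then show ?thesis
    unfolding canonical_trace_s_seq_power by (intro tendsto_of_real) simp
qed

section \<open>Comparison with the normal distribution\<close>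

lemma double_factorial_odd: "real (double_factorial (2 * k - 1)) = fact (2 * k) / (2 ^ k * fact k)"
proof (induction k)
  case (Suc k)
  have num: "fact (2 * Suc k) = 2 * (real k + 1) * ((2 * real k + 1) * fact (2 * k))"
    by (simp add: algebra_simps)
  have den: "2 ^ Suc k * fact (Suc k) = 2 * (real k + 1) * (2 ^ k * fact k)"
    by (simp add: algebra_simps)
  have "real (double_factorial (2 * Suc k - 1)) = (2 * real k + 1) * real (double_factorial (2 * k - 1))"
    by (cases k) (auto simp: algebra_simps)
  also have "\<dots> = fact (2 * Suc k) / (2 ^ Suc k * fact (Suc k))"
    unfolding num den Suc.IH by (subst mult_divide_mult_cancel_left) auto
  finally show ?case .
qed simp

lemma has_bochner_integral_std_normal_power:
  "has_bochner_integral lborel (\<lambda>x. std_normal_density x * x ^ d) (gaussian_moment d)"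
proof (cases "even d")
  case True
  then obtain k where "d = 2 * k" by (auto elim: evenE)
  with std_normal_moment_even[of k] double_factorial_odd[of k] show ?thesis
    by (simp add: gaussian_moment_def)
next
  case False
  then obtain k where "d = 2 * k + 1" by (auto elim: oddE)
  with std_normal_moment_odd[of k] show ?thesis by (simp add: gaussian_moment_def)
qed

theorem theorem1p3:
  shows "(\<forall>d::nat\<ge>1. (\<lambda>n. canonical_trace (s_seq n ^ d)) \<longlonglongrightarrow>
            (if even d then of_nat (double_factorial (d - 1)) else 0))
       \<and> (\<forall>(M :: 'b measure) (X :: 'b \<Rightarrow> real).
            prob_space M \<longrightarrow> distributed M lborel X std_normal_density \<longrightarrow>
            converges_in_distribution_to (\<lambda>_. canonical_trace) s_seq M X)"
proof (intro conjI allI impI)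
  fix d :: nat
  have "complex_of_real (gaussian_moment d) = (if even d then of_nat (double_factorial (d - 1)) else 0)"
    by (simp add: gaussian_moment_def)
  with tendsto_canonical_trace_s_seq_power[of d]
  show "(\<lambda>n. canonical_trace (s_seq n ^ d)) \<longlonglongrightarrow>
      (if even d then of_nat (double_factorial (d - 1)) else 0)" by simp
next
  fix M :: "'b measure" and X :: "'b \<Rightarrow> real"
  assume "prob_space M" and X: "distributed M lborel X std_normal_density"
  show "converges_in_distribution_to (\<lambda>_. canonical_trace) s_seq M X"
    unfolding converges_in_distribution_to_def
  proof (intro allI impI conjI)
    fix d :: nat
    have moment: "integrable lborel (\<lambda>x. std_normal_density x * x ^ d)"
      "(\<integral>x. std_normal_density x * x ^ d \<partial>lborel) = gaussian_moment d"
      using has_bochner_integral_std_normal_power[of d]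
      by (auto simp: has_bochner_integral_iff)
    then show "integrable M (\<lambda>\<omega>. X \<omega> ^ d)"
      using distributed_integrable[OF X, of "\<lambda>x. x ^ d"] by simp
    have "(\<integral>\<omega>. X \<omega> ^ d \<partial>M) = gaussian_moment d"
      using distributed_integral[OF X, of "\<lambda>x. x ^ d"] moment(2) by simp
    with tendsto_canonical_trace_s_seq_power[of d]
    show "(\<lambda>n. canonical_trace (s_seq n ^ d)) \<longlonglongrightarrow> complex_of_real (\<integral>\<omega>. X \<omega> ^ d \<partial>M)" by simp
  qed
qed

end
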